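(* Let $X\subset\mathbb{RP}^3$ be the open set of scaling classes of real cubics with negative discriminant, and let $\mathcal{R}_{\mathbb{C}}\colon X\to\mathbb{C}$ send a cubic to its unique root with positive imaginary part. Let $\mathcal{S}\subset X$ be the intersection with $X$ of a projective line or projective plane of $\mathbb{RP}^3$ (a one- or two-dimensional affine space of real cubics in the space of projectivized coefficients), with $\mathcal{S}$ nonempty. Under the identification of $X$ with the unit tangent bundle of the hyperbolic plane, $X$ is foliated by simple closed curves (the fibers of the unit tangent bundle). Then the restriction $\mathcal{R}_{\mathbb{C}}|_{\mathcal{S}}\colon\mathcal{S}\to\mathbb{C}$ is an embedding if and only if $\mathcal{S}$ is everywhere transverse to this fibration.
   Context: Cubics are binary cubic forms $ax^3+bx^2y+cxy^2+dy^3$ with real coefficients, up to scaling, identified with $[a:b:c:d]\in\mathbb{RP}^3$; negative discriminant means one root in $\mathbb{RP}^1$ and a pair of non-real complex conjugate roots. The fiber through a cubic with non-real roots $z,\overline z$ is the projective line $L_z$ of all real cubics of the form $(sx+ty)(x-zy)(x-\overline zy)$, $[s:t]\in\mathbb{RP}^1$. $\mathcal{S}$ is transverse to the fibration at $p\in\mathcal{S}$ if the tangent line at $p$ of the fiber through $p$ is not contained in $T_p\mathcal{S}$. An embedding is an injective immersion that is a homeomorphism onto its image. *)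

theory Defs
  imports "HOL-Analysis.Analysis"
begin

subsection \<open>Smooth maps, tangent vectors and immersions in Euclidean spaces\<close>

text \<open>\<open>Ck_on k U f\<close> is only meant for open \<open>U\<close>.  In finite dimension, continuity of all
  iterated directional derivatives is the usual notion of class \<open>C\<^sup>k\<close>.\<close>

primrec Ck_on :: "nat \<Rightarrow> 'a::euclidean_space set \<Rightarrow> ('a \<Rightarrow> 'b::real_normed_vector) \<Rightarrow> bool" where
  "Ck_on 0 U f \<longleftrightarrow> continuous_on U f"
| "Ck_on (Suc k) U f \<longleftrightarrow> (\<forall>x\<in>U. f differentiable (at x)) \<and>
     (\<forall>v. Ck_on k U (\<lambda>x. frechet_derivative f (at x) v))"

definition smooth_on :: "'a::euclidean_space set \<Rightarrow> ('a \<Rightarrow> 'b::real_normed_vector) \<Rightarrow> bool" where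
  "smooth_on U f \<longleftrightarrow> (\<forall>k. Ck_on k U f)"

text \<open>Velocities at \<open>y\<close> of smooth curves contained in \<open>M\<close>; this is the usual tangent space when
  \<open>M\<close> is a submanifold and \<open>y \<in> M\<close>.\<close>

definition tangent_space :: "'a::euclidean_space set \<Rightarrow> 'a \<Rightarrow> 'a set" where
  "tangent_space M y = {v. \<exists>c e. 0 < e \<and> smooth_on {-e<..<e} c \<and> c ` {-e<..<e} \<subseteq> M \<and> c 0 = y \<and>
     (c has_vector_derivative v) (at (0::real))}"

text \<open>For a submanifold \<open>M\<close>, smoothness of a map on \<open>M\<close> means that it extends smoothly to the ambient
  space near every point; its differential is the restriction to the tangent space of \<open>M\<close> of the
  differential of any such extension.\<close>

definition immersion_on :: "'a::euclidean_space set \<Rightarrow> ('a \<Rightarrow> 'b::real_normed_vector) \<Rightarrow> bool" where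
  "immersion_on M f \<longleftrightarrow> (\<forall>y\<in>M. \<exists>U g. open U \<and> y \<in> U \<and> smooth_on U g \<and> (\<forall>x\<in>M \<inter> U. g x = f x) \<and>
     inj_on (frechet_derivative g (at y)) (tangent_space M y))"


subsection \<open>Real projective 3-space\<close>

typedef rp3 = "{L :: (real^4) set. subspace L \<and> dim L = 1}"
proof -
  have "(axis 1 1 :: real^4) \<noteq> 0"
    by (simp add: axis_eq_0_iff)
  then have "independent {axis 1 1 :: real^4}"
    by (simp only: dependent_single not_False_eq_True)
  then have "dim (span {axis 1 1 :: real^4}) = 1"
    by (simp only: dim_span dim_eq_card_independent) simp
  then have "span {axis 1 1 :: real^4} \<in> {L. subspace L \<and> dim L = 1}"
    by (simp only: mem_Collect_eq subspace_span simp_thms)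
  then show ?thesis
    by (rule exI)
qed

text \<open>Only meaningful for nonzero vectors.\<close>

definition proj :: "real^4 \<Rightarrow> rp3" where
  "proj v = Abs_rp3 (span {v})"

text \<open>The quotient topology of the nonzero vectors modulo scaling.\<close>

instantiation rp3 :: topological_space
begin

definition open_rp3 :: "rp3 set \<Rightarrow> bool" where
  "open_rp3 U \<longleftrightarrow> open {v. v \<noteq> 0 \<and> proj v \<in> U}"

instance
proof
  have "{v::real^4. v \<noteq> 0 \<and> proj v \<in> UNIV} = - {0}"
    by auto
  then show "open (UNIV :: rp3 set)"
    unfolding open_rp3_def by (simp add: open_Compl)
next
  fix A B :: "rp3 set"
  assume "open A" "open B"
  moreover have "{v. v \<noteq> 0 \<and> proj v \<in> A \<inter> B} = {v. v \<noteq> 0 \<and> proj v \<in> A} \<inter> {v. v \<noteq> 0 \<and> proj v \<in> B}"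
    by auto
  ultimately show "open (A \<inter> B)"
    unfolding open_rp3_def by (simp only: open_Int)
next
  fix K :: "rp3 set set"
  assume "\<forall>A\<in>K. open A"
  moreover have "{v. v \<noteq> 0 \<and> proj v \<in> \<Union>K} = (\<Union>A\<in>K. {v. v \<noteq> 0 \<and> proj v \<in> A})"
    by auto
  ultimately show "open (\<Union>K)"
    unfolding open_rp3_def by (simp only: open_UN)
qed

end

text \<open>\<open>projective_subspace 1\<close> and \<open>projective_subspace 2\<close> are the projective lines and planes.\<close>

definition projective_subspace :: "nat \<Rightarrow> rp3 set \<Rightarrow> bool" where
  "projective_subspace k P \<longleftrightarrow> (\<exists>W. subspace W \<and> dim W = k + 1 \<and> P = {p. Rep_rp3 p \<subseteq> W})"

text \<open>The inverses of the four standard affine charts; they define the smooth structure.\<close>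

definition affine_params :: "(real^3 \<Rightarrow> rp3) set" where
  "affine_params =
     {\<lambda>y. proj (vector [1, y$1, y$2, y$3]),
      \<lambda>y. proj (vector [y$1, 1, y$2, y$3]),
      \<lambda>y. proj (vector [y$1, y$2, 1, y$3]),
      \<lambda>y. proj (vector [y$1, y$2, y$3, 1])}"

text \<open>Tangency is expressed in affine coordinates.  Since changes of coordinates are
  diffeomorphisms, quantifying over all charts around a point amounts to choosing one of them.\<close>

definition rp3_immersion_on :: "rp3 set \<Rightarrow> (rp3 \<Rightarrow> 'b::real_normed_vector) \<Rightarrow> bool" where
  "rp3_immersion_on S f \<longleftrightarrow> (\<forall>\<psi>\<in>affine_params. immersion_on (\<psi> -` S) (f \<circ> \<psi>))"

definition rp3_embedding_on :: "rp3 set \<Rightarrow> (rp3 \<Rightarrow> 'b::real_normed_vector) \<Rightarrow> bool" where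
  "rp3_embedding_on S f \<longleftrightarrow>
     inj_on f S \<and> rp3_immersion_on S f \<and> (\<exists>g. homeomorphism S (f ` S) f g)"

definition rp3_tangent_subset :: "rp3 \<Rightarrow> rp3 set \<Rightarrow> rp3 set \<Rightarrow> bool" where
  "rp3_tangent_subset p M N \<longleftrightarrow> (\<forall>\<psi>\<in>affine_params. \<forall>y. \<psi> y = p \<longrightarrow>
     tangent_space (\<psi> -` M) y \<subseteq> tangent_space (\<psi> -` N) y)"


subsection \<open>Binary cubic forms\<close>

definition cubic_form :: "real^4 \<Rightarrow> complex \<Rightarrow> complex \<Rightarrow> complex" where
  "cubic_form v x y = of_real (v$1) * x^3 + of_real (v$2) * x^2 * y
     + of_real (v$3) * x * y^2 + of_real (v$4) * y^3"

definition cubic_disc :: "real^4 \<Rightarrow> real" where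
  "cubic_disc v = (let a = v$1; b = v$2; c = v$3; d = v$4 in
     b^2 * c^2 - 4 * a * c^3 - 4 * b^3 * d - 27 * a^2 * d^2 + 18 * a * b * c * d)"

text \<open>The discriminant is homogeneous of even degree, so its sign does not depend on the
  representative; it vanishes at \<open>0\<close>.\<close>

definition neg_disc_cubics :: "rp3 set" where
  "neg_disc_cubics = proj ` {v. cubic_disc v < 0}"

text \<open>A non-real root is a point \<open>[z : 1]\<close>: the root at infinity \<open>[1 : 0]\<close> is real.\<close>

definition nonreal_root :: "rp3 \<Rightarrow> complex" where
  "nonreal_root p = (THE z. 0 < Im z \<and> (\<forall>v\<in>Rep_rp3 p. cubic_form v z 1 = 0))"

definition cubic_fiber :: "complex \<Rightarrow> rp3 set" where
  "cubic_fiber z = {proj v | v. \<exists>s t :: real. (s, t) \<noteq> (0, 0) \<and>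
     (\<forall>x y. cubic_form v x y = (of_real s * x + of_real t * y) * (x - z * y) * (x - cnj z * y))}"

definition transverse_to_fiber_at :: "rp3 set \<Rightarrow> rp3 \<Rightarrow> bool" where
  "transverse_to_fiber_at S p \<longleftrightarrow> \<not> rp3_tangent_subset p (cubic_fiber (nonreal_root p)) S"

end

theory Submission
  imports Defs "HOL-Computational_Algebra.Fundamental_Theorem_Algebra"
begin

text \<open>The fiber over \<open>z\<close> is the projectivization of the plane \<open>F\<^sub>z\<close> of cubics vanishing at \<open>z\<close>.
  If \<open>\<S>\<close> is cut out by the linear subspace \<open>W\<close>, it is transverse to this fiber iff
  \<open>F\<^sub>z \<subseteq> W\<close> fails, since a projective line tangent to a projective subspace lies in it.  A fiber
  contained in \<open>\<S>\<close> is collapsed to a point, so injectivity forces transversality.  Conversely, the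
  root \<open>r\<close> of a cubic \<open>f\<close> is smooth with derivative \<open>h \<mapsto> - h(r) / f'(r)\<close>, whose kernel is
  \<open>F\<^sub>r\<close>; if all intersections \<open>F\<^sub>z \<inter> W\<close> are at most one-dimensional, the root is therefore an
  injective immersion on \<open>\<S>\<close>, and \<open>F\<^sub>z \<inter> W\<close> depends continuously on \<open>z\<close>.\<close>

subsection \<open>Closure properties of \<open>C\<^sup>k\<close> functions\<close>

text \<open>On an open set derivatives depend only on the values there; this matters because
  functions are total but only specified on \<open>U\<close>.\<close>

lemma Ck_on_cong:
  assumes "open U" and "\<And>x. x \<in> U \<Longrightarrow> f x = g x"
  shows "Ck_on k U f \<longleftrightarrow> Ck_on k U g"
  using assms(2)
proof (induction k arbitrary: f g)
  case 0
  then show ?case by (simp cong: continuous_on_cong)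
next
  case (Suc k)
  have *: "(f has_derivative D) (at x) \<longleftrightarrow> (g has_derivative D) (at x)" if "x \<in> U" for x D
    using has_derivative_transform_within_open[of f D x UNIV U g]
      has_derivative_transform_within_open[of g D x UNIV U f] Suc.prems \<open>open U\<close> that by auto
  have "frechet_derivative f (at x) = frechet_derivative g (at x)"
    and "f differentiable (at x) \<longleftrightarrow> g differentiable (at x)" if "x \<in> U" for x
    using *[OF that] by (simp_all add: frechet_derivative_def differentiable_def)
  moreover from this have "Ck_on k U (\<lambda>x. frechet_derivative f (at x) v) \<longleftrightarrow>
      Ck_on k U (\<lambda>x. frechet_derivative g (at x) v)" for v
    by (intro Suc.IH) simp
  ultimately show ?case by simp
qed

text \<open>The working rule for inductions on \<open>k\<close>: an explicit formula for the
  derivative may stand in for \<open>frechet_derivative\<close>.\<close>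

lemma Ck_on_SucI:
  assumes "open U" and "\<And>x. x \<in> U \<Longrightarrow> (f has_derivative f' x) (at x)"
    and "\<And>v. Ck_on k U (\<lambda>x. f' x v)"
  shows "Ck_on (Suc k) U f"
proof -
  have "f differentiable (at x)" if "x \<in> U" for x
    using assms(2)[OF that] by (auto simp: differentiable_def)
  moreover have "Ck_on k U (\<lambda>x. frechet_derivative f (at x) v)" for v
  proof -
    have "frechet_derivative f (at x) v = f' x v" if "x \<in> U" for x
      using frechet_derivative_at[OF assms(2)[OF that]] by simp
    then show ?thesis
      using Ck_on_cong[OF assms(1), of "\<lambda>x. frechet_derivative f (at x) v" "\<lambda>x. f' x v"] assms(3)
      by blast
  qed
  ultimately show ?thesis by simp
qed

lemma Ck_on_Suc_has_derivative:
  "Ck_on (Suc k) U f \<Longrightarrow> x \<in> U \<Longrightarrow> (f has_derivative frechet_derivative f (at x)) (at x)"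
  by (simp add: frechet_derivative_works)

lemma Ck_on_SucD: "Ck_on (Suc k) U f \<Longrightarrow> Ck_on k U f"
proof (induction k arbitrary: f)
  case 0
  then show ?case
    by (auto intro!: continuous_at_imp_continuous_on differentiable_imp_continuous_within)
next
  case (Suc k)
  then show ?case
    using Ck_on.simps(2)[of k U f] Ck_on.simps(2)[of "Suc k" U f] by blast
qed

lemma Ck_on_const: "open U \<Longrightarrow> Ck_on k U (\<lambda>x. c)"
proof (induction k arbitrary: c)
  case (Suc k)
  then show ?case by (intro Ck_on_SucI[where f' = "\<lambda>x h. 0"]) auto
qed simp

lemma Ck_on_affine:
  assumes "open U" and "bounded_linear L"
  shows "Ck_on k U (\<lambda>x. c + L x)"
proof (cases k)
  case 0
  then show ?thesis
    using assms by (auto intro!: continuous_intros bounded_linear.continuous_on[OF assms(2)])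
next
  case (Suc m)
  then show ?thesis
    using assms
    by (auto simp del: Ck_on.simps intro!: Ck_on_SucI[where f' = "\<lambda>x. L"] Ck_on_const
        derivative_eq_intros bounded_linear_imp_has_derivative)
qed

lemma Ck_on_add:
  assumes "open U" and "Ck_on k U f" and "Ck_on k U g"
  shows "Ck_on k U (\<lambda>x. f x + g x)"
  using assms(2,3)
proof (induction k arbitrary: f g)
  case 0
  then show ?case by (simp add: continuous_on_add)
next
  case (Suc k)
  note D = Suc.prems[THEN Ck_on_Suc_has_derivative]
  show ?case
    by (rule Ck_on_SucI[OF assms(1) has_derivative_add[OF D]]) (use Suc in auto)
qed

lemma Ck_on_mult:
  fixes f g :: "'a::euclidean_space \<Rightarrow> 'b::real_normed_algebra"
  assumes "open U" and "Ck_on k U f" and "Ck_on k U g"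
  shows "Ck_on k U (\<lambda>x. f x * g x)"
  using assms(2,3)
proof (induction k arbitrary: f g)
  case 0
  then show ?case by (simp add: continuous_on_mult)
next
  case (Suc k)
  note D = Suc.prems[THEN Ck_on_Suc_has_derivative]
  show ?case
  proof (rule Ck_on_SucI[OF assms(1) has_derivative_mult[OF D]])
    show "Ck_on k U (\<lambda>x. f x * frechet_derivative g (at x) v + frechet_derivative f (at x) v * g x)"
      for v
      using Suc.prems[THEN Ck_on_SucD] Suc.prems[unfolded Ck_on.simps(2)]
      by (intro Ck_on_add Suc.IH assms(1)) blast+
  qed auto
qed

text \<open>The derivative contains the inverse itself, whose class \<open>C^k\<close> comes from
  the induction hypothesis. The sign is written as multiplication by the constant \<open>- 1\<close>
  so that the product rule covers it.\<close>

lemma Ck_on_inverse: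
  fixes f :: "'a::euclidean_space \<Rightarrow> 'b::real_normed_field"
  assumes "open U" and "Ck_on k U f" and "\<And>x. x \<in> U \<Longrightarrow> f x \<noteq> 0"
  shows "Ck_on k U (\<lambda>x. inverse (f x))"
  using assms(2)
proof (induction k)
  case 0
  then show ?case using assms(3) by (auto intro: continuous_on_inverse)
next
  case (Suc k)
  have inv: "Ck_on k U (\<lambda>x. inverse (f x))"
    using Suc Ck_on_SucD by blast
  note mult = Ck_on_mult[OF assms(1)]
  show ?case
  proof (rule Ck_on_SucI[OF assms(1)])
    show "((\<lambda>x. inverse (f x)) has_derivative
        (\<lambda>v. (- 1) * (inverse (f x) * frechet_derivative f (at x) v * inverse (f x)))) (at x)"
      if "x \<in> U" for x
      using Deriv.has_derivative_inverse[OF assms(3)[OF that] Ck_on_Suc_has_derivative[OF Suc.prems that]]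
      by simp
    show "Ck_on k U (\<lambda>x. (- 1) * (inverse (f x) * frechet_derivative f (at x) v * inverse (f x)))" for v
      using Suc.prems by (intro mult inv Ck_on_const assms(1)) auto
  qed
qed

lemma Ck_on_power:
  fixes f :: "'a::euclidean_space \<Rightarrow> 'b::real_normed_field"
  assumes "open U" and "Ck_on k U f"
  shows "Ck_on k U (\<lambda>x. f x ^ n)"
  by (induction n) (auto intro!: Ck_on_mult Ck_on_const assms)

text \<open>By the chain rule the derivative in direction \<open>v\<close> is the derivative of
  \<open>f\<close> in the fixed direction \<open>L v\<close>, precomposed with the same affine map,
  so the induction closes with \<open>f\<close> varying.\<close>

lemma Ck_on_compose_affine:
  fixes L :: "'a::euclidean_space \<Rightarrow> 'b::euclidean_space"
  assumes "open U" and "open V" and "bounded_linear L" and "\<And>x. x \<in> V \<Longrightarrow> c + L x \<in> U"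
    and "Ck_on k U f"
  shows "Ck_on k V (\<lambda>x. f (c + L x))"
  using assms(5)
proof (induction k arbitrary: f)
  case 0
  then show ?case
    using assms(4)
    by (auto intro!: continuous_on_compose2[of U f] continuous_intros
        bounded_linear.continuous_on[OF assms(3)])
next
  case (Suc k)
  show ?case
  proof (rule Ck_on_SucI[OF assms(2)])
    fix x assume "x \<in> V"
    have "((\<lambda>x. c + L x) has_derivative L) (at x)"
      by (auto intro!: derivative_eq_intros bounded_linear_imp_has_derivative assms(3))
    then show "((\<lambda>x. f (c + L x)) has_derivative
        (\<lambda>h. frechet_derivative f (at (c + L x)) (L h))) (at x)"
      by (rule has_derivative_compose) (use Suc.prems assms(4) \<open>x \<in> V\<close> Ck_on_Suc_has_derivative in blast)
  next
    show "Ck_on k V (\<lambda>x. frechet_derivative f (at (c + L x)) (L v))" for v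
      using Suc.prems by (intro Suc.IH) simp
  qed
qed

text \<open>A product rule at a zero of the linear factor, where continuity of \<open>B\<close>
  suffices: the error \<open>l (x - v) * (B x - B v)\<close> is of smaller order than
  \<open>norm (x - v)\<close>.\<close>

lemma has_derivative_linear_mult_isCont:
  fixes l B :: "'a::real_normed_vector \<Rightarrow> 'b::real_normed_algebra"
  assumes l: "bounded_linear l" and B: "isCont B v"
  shows "((\<lambda>x. l (x - v) * B x) has_derivative (\<lambda>h. l h * B v)) (at v)"
proof -
  obtain K where K: "norm (l x) \<le> norm x * K" for x
    using bounded_linear.bounded[OF l] by blast
  have lim: "((\<lambda>x. K * norm (B x - B v)) \<longlongrightarrow> 0) (at v)"
    using B by (auto simp: isCont_def intro!: tendsto_eq_intros)
  have bound: "norm ((l (x - v) * B x - l (x - v) * B v) /\<^sub>R norm (x - v)) \<le> K * norm (B x - B v)"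
    if "x \<noteq> v" for x
  proof -
    have "norm (l (x - v) * B x - l (x - v) * B v) \<le> norm (l (x - v)) * norm (B x - B v)"
      by (metis norm_mult_ineq right_diff_distrib)
    also have "\<dots> \<le> (norm (x - v) * K) * norm (B x - B v)"
      by (intro mult_right_mono K) auto
    finally show ?thesis using that by (simp only: norm_scaleR) (simp add: field_simps)
  qed
  have "((\<lambda>x. (l (x - v) * B x - l (x - v) * B v) /\<^sub>R norm (x - v)) \<longlongrightarrow> 0) (at v)"
    by (rule Lim_null_comparison[OF _ lim])
      (use bound in \<open>unfold eventually_at_filter, intro always_eventually, blast\<close>)
  moreover have "bounded_linear (\<lambda>h. l h * B v)"
    using bounded_linear_compose[OF bounded_linear_mult_left l] by simp
  ultimately show ?thesis
    using linear_0[OF bounded_linear.linear[OF l]] by (simp add: has_derivative_at2 inverse_eq_divide)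
qed


subsection \<open>Points and charts of projective space\<close>

lemma Rep_rp3_proj: "v \<noteq> 0 \<Longrightarrow> Rep_rp3 (proj v) = span {v}"
  unfolding proj_def by (intro Abs_rp3_inverse) (simp add: dim_insert)

lemma rp3_cases:
  obtains v where "v \<noteq> 0" and "p = proj v"
proof -
  have sub: "subspace (Rep_rp3 p)" and dim: "dim (Rep_rp3 p) = 1"
    using Rep_rp3[of p] by auto
  obtain B where B: "B \<subseteq> Rep_rp3 p" "independent B" "Rep_rp3 p \<subseteq> span B" "card B = 1"
    using basis_exists[of "Rep_rp3 p"] dim by metis
  then obtain v where v: "B = {v}" by (metis card_1_singletonE)
  have "v \<noteq> 0" using B(2) v by (simp add: dependent_single)
  moreover have "Rep_rp3 p = span {v}"
    using B v sub by (metis span_minimal subset_antisym)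
  ultimately show ?thesis
    using that by (metis Rep_rp3_inverse proj_def)
qed

lemma proj_eq_iff:
  assumes "v \<noteq> 0" and "w \<noteq> 0"
  shows "proj v = proj w \<longleftrightarrow> (\<exists>k. v = k *\<^sub>R w)"
proof
  assume "proj v = proj w"
  then have "span {v} = span {w}" using assms Rep_rp3_proj by metis
  then have "v \<in> span {w}" by (metis span_base singletonI)
  then show "\<exists>k. v = k *\<^sub>R w" by (auto simp: span_singleton)
next
  assume "\<exists>k. v = k *\<^sub>R w"
  then obtain k where k: "v = k *\<^sub>R w" by blast
  with assms have "k \<noteq> 0" by auto
  then have "span {v} = span {w}" using k span_image_scale[of "{w}" "\<lambda>_. k"] by simp
  then show "proj v = proj w" by (simp add: proj_def)
qed

lemma proj_scale: "k \<noteq> 0 \<Longrightarrow> v \<noteq> 0 \<Longrightarrow> proj (k *\<^sub>R v) = proj v"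
  by (subst proj_eq_iff) auto

lemma Rep_rp3_proj_subset_iff: "v \<noteq> 0 \<Longrightarrow> subspace W \<Longrightarrow> Rep_rp3 (proj v) \<subseteq> W \<longleftrightarrow> v \<in> W"
  using span_minimal[of "{v}" W] span_base[of v "{v}"] by (auto simp: Rep_rp3_proj)

lemma vector_4_nth [simp]:
  "(vector [x, y, z, w] :: 'a::zero^4) $ 1 = x"
  "(vector [x, y, z, w] :: 'a::zero^4) $ 2 = y"
  "(vector [x, y, z, w] :: 'a::zero^4) $ 3 = z"
  "(vector [x, y, z, w] :: 'a::zero^4) $ 4 = w"
  by (simp_all add: vector_def)

text \<open>A common shape for the four charts, with \<open>L\<close> parametrizing a coordinate
  hyperplane, so that later arguments avoid a case split over charts.\<close>

lemma affine_params_cases: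
  assumes "\<psi> \<in> affine_params"
  obtains i e L where "linear L" and "inj L" and "range L = {v. v $ i = 0}" and "e $ i = 1"
    and "\<And>y. e + L y \<noteq> 0" and "\<psi> = (\<lambda>y. proj (e + L y))"
proof -
  note result = that
  \<comment> \<open>\<open>A\<close> is the affine lift of the chart and \<open>M\<close> forgets
    coordinate \<open>i\<close>; \<open>left\<close> and \<open>right\<close> make them mutually
    inverse between the parameter space and the hyperplane \<open>v $ i = 1\<close>.\<close>
  have chart: thesis
    if \<psi>: "\<psi> = (\<lambda>y. proj (A y))" and A0: "A 0 $ i = 1" and lin: "linear (\<lambda>y. A y - A 0)"
      and left: "\<And>y. M (A y) = y" and right: "\<And>v. v $ i = 1 \<longleftrightarrow> A (M v) = v"
    for A i and M :: "real^4 \<Rightarrow> real^3"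
  proof (rule result[of "\<lambda>y. A y - A 0" i "A 0"])
    show "inj (\<lambda>y. A y - A 0)"
    proof (rule injI)
      fix x y assume "A x - A 0 = A y - A 0"
      then have "M (A x) = M (A y)" by simp
      then show "x = y" by (simp add: left)
    qed
    have "v \<in> range (\<lambda>y. A y - A 0)" if "v $ i = 0" for v
      using right[of "v + A 0"] that A0 by (intro image_eqI[of _ _ "M (v + A 0)"]) auto
    moreover have A1: "A y $ i = 1" for y using right[of "A y"] by (simp add: left)
    ultimately show "range (\<lambda>y. A y - A 0) = {v. v $ i = 0}" using A0 by auto
    show "A 0 + (A y - A 0) \<noteq> 0" for y using A1[of y] by auto
  qed (use lin A0 \<psi> in auto)
  note vec_simps = vec_eq_iff forall_4 forall_3
  show thesis
    using assms unfolding affine_params_def insert_iff empty_iff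
  proof (elim disjE)
    assume "\<psi> = (\<lambda>y. proj (vector [1, y$1, y$2, y$3]))"
    then show thesis
      by (rule chart[where i = 1 and M = "\<lambda>v. vector [v$2, v$3, v$4]"])
        (auto simp: vec_simps intro!: linearI)
  next
    assume "\<psi> = (\<lambda>y. proj (vector [y$1, 1, y$2, y$3]))"
    then show thesis
      by (rule chart[where i = 2 and M = "\<lambda>v. vector [v$1, v$3, v$4]"])
        (auto simp: vec_simps intro!: linearI)
  next
    assume "\<psi> = (\<lambda>y. proj (vector [y$1, y$2, 1, y$3]))"
    then show thesis
      by (rule chart[where i = 3 and M = "\<lambda>v. vector [v$1, v$2, v$4]"])
        (auto simp: vec_simps intro!: linearI)
  next
    assume "\<psi> = (\<lambda>y. proj (vector [y$1, y$2, y$3, 1]))"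
    then show thesis
      by (rule chart[where i = 4 and M = "\<lambda>v. vector [v$1, v$2, v$3]"])
        (auto simp: vec_simps intro!: linearI)
  qed simp
qed

lemma affine_params_cover:
  assumes "v \<noteq> 0"
  obtains \<psi> y where "\<psi> \<in> affine_params" and "\<psi> y = proj v"
proof -
  note result = that
  have cover: thesis
    if "\<psi> \<in> affine_params" and "\<psi> = (\<lambda>y. proj (A y))" and "v $ i \<noteq> 0"
      and "A y = (1 / v $ i) *\<^sub>R v" for \<psi> A i y
    using that assms proj_scale[of "1 / v $ i" v] by (intro result[of \<psi> y]) simp_all
  from assms consider "v $ 1 \<noteq> 0" | "v $ 2 \<noteq> 0" | "v $ 3 \<noteq> 0" | "v $ 4 \<noteq> 0"
    by (auto simp: vec_eq_iff forall_4)
  then show thesis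
  proof cases
    case 1
    show thesis
      by (rule cover[OF _ refl 1, of "\<lambda>y. vector [1, y$1, y$2, y$3]"
            "vector [v$2 / v$1, v$3 / v$1, v$4 / v$1]"])
        (use 1 in \<open>simp_all add: affine_params_def vec_eq_iff forall_4\<close>)
  next
    case 2
    show thesis
      by (rule cover[OF _ refl 2, of "\<lambda>y. vector [y$1, 1, y$2, y$3]"
            "vector [v$1 / v$2, v$3 / v$2, v$4 / v$2]"])
        (use 2 in \<open>simp_all add: affine_params_def vec_eq_iff forall_4\<close>)
  next
    case 3
    show thesis
      by (rule cover[OF _ refl 3, of "\<lambda>y. vector [y$1, y$2, 1, y$3]"
            "vector [v$1 / v$3, v$2 / v$3, v$4 / v$3]"])
        (use 3 in \<open>simp_all add: affine_params_def vec_eq_iff forall_4\<close>)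
  next
    case 4
    show thesis
      by (rule cover[OF _ refl 4, of "\<lambda>y. vector [y$1, y$2, y$3, 1]"
            "vector [v$1 / v$4, v$2 / v$4, v$3 / v$4]"])
        (use 4 in \<open>simp_all add: affine_params_def vec_eq_iff forall_4\<close>)
  qed
qed


subsection \<open>The fibers\<close>

text \<open>The coefficients of \<open>(s x + t y) (x - z y) (x - cnj z y)\<close>.\<close>

definition fiber_vec :: "real \<Rightarrow> real \<Rightarrow> complex \<Rightarrow> real^4" where
  "fiber_vec s t z = vector [s, t - 2 * Re z * s, (cmod z)\<^sup>2 * s - 2 * Re z * t, (cmod z)\<^sup>2 * t]"

lemma fiber_vec_nth [simp]:
  "fiber_vec s t z $ 1 = s"
  "fiber_vec s t z $ 2 = t - 2 * Re z * s"
  "fiber_vec s t z $ 3 = (cmod z)\<^sup>2 * s - 2 * Re z * t"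
  "fiber_vec s t z $ 4 = (cmod z)\<^sup>2 * t"
  by (simp_all add: fiber_vec_def)

lemma fiber_vec_linear: "fiber_vec s t z = s *\<^sub>R fiber_vec 1 0 z + t *\<^sub>R fiber_vec 0 1 z"
  by (simp add: vec_eq_iff forall_4 algebra_simps)

lemma fiber_vec_eq_0_iff: "fiber_vec s t z = 0 \<longleftrightarrow> s = 0 \<and> t = 0"
  by (auto simp: vec_eq_iff forall_4)

lemma cubic_form_fiber_vec:
  "cubic_form (fiber_vec s t z) x y = (of_real s * x + of_real t * y) * (x - z * y) * (x - cnj z * y)"
proof -
  have 1: "of_real (2 * Re z) = z + cnj z" by (simp add: complex_add_cnj)
  have 2: "of_real ((cmod z)\<^sup>2) = z * cnj z" by (rule complex_norm_square)
  show ?thesis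
    unfolding cubic_form_def fiber_vec_nth of_real_diff of_real_mult[of "2 * Re z"]
      of_real_mult[of "(cmod z)\<^sup>2"] 1 2
    by (simp add: algebra_simps power2_eq_square power3_eq_cube)
qed

text \<open>The product of squared root differences: the conjugate pair contributes
  \<open>- 4 * (Im z)^2\<close>, and its differences with the real root contribute
  \<open>cmod (s * z + t)^4\<close>.\<close>

lemma cubic_disc_fiber_vec:
  "cubic_disc (fiber_vec s t z) = - (4 * (Im z)\<^sup>2 * ((s * Re z + t)\<^sup>2 + (s * Im z)\<^sup>2)\<^sup>2)"
  unfolding cubic_disc_def fiber_vec_nth Let_def cmod_power2
  by (simp add: algebra_simps power2_eq_square power3_eq_cube)

lemma cubic_disc_fiber_vec_neg:
  assumes "Im z > 0" and "(s, t) \<noteq> (0, 0)"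
  shows "cubic_disc (fiber_vec s t z) < 0"
proof -
  have "(s * Re z + t)\<^sup>2 + (s * Im z)\<^sup>2 \<noteq> 0"
    using assms by (auto simp: sum_power2_eq_zero_iff)
  then show ?thesis using assms by (simp add: cubic_disc_fiber_vec)
qed

lemma cubic_form_add: "cubic_form (v + w) x y = cubic_form v x y + cubic_form w x y"
  by (simp add: cubic_form_def algebra_simps)

lemma cubic_form_diff: "cubic_form (v - w) x y = cubic_form v x y - cubic_form w x y"
  by (simp add: cubic_form_def algebra_simps)

lemma cubic_form_scale: "cubic_form (k *\<^sub>R v) x y = of_real k * cubic_form v x y"
  by (simp add: cubic_form_def algebra_simps)

text \<open>Division with remainder of a cubic by the real quadratic with roots \<open>z\<close> and \<open>cnj z\<close>.\<close>

lemma fiber_vec_of_root: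
  assumes "Im z > 0" and "cubic_form v z 1 = 0"
  shows "v = fiber_vec (v $ 1) (v $ 2 + 2 * Re z * v $ 1) z"
proof -
  define t where "t = v $ 2 + 2 * Re z * v $ 1"
  \<comment> \<open>With the two leading coefficients matched, \<alpha> and \<beta> are those of the
    remainder; as they are real and \<open>z\<close> is not, \<open>\<alpha> z + \<beta> = 0\<close>
    forces both to vanish.\<close>
  define \<alpha> where "\<alpha> = v $ 3 - (cmod z)\<^sup>2 * v $ 1 + 2 * Re z * t"
  define \<beta> where "\<beta> = v $ 4 - (cmod z)\<^sup>2 * t"
  have "v = fiber_vec (v $ 1) t z + (\<alpha> *\<^sub>R axis 3 1 + \<beta> *\<^sub>R axis 4 1)"
    by (simp add: vec_eq_iff forall_4 \<alpha>_def \<beta>_def t_def axis_def)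
  then have "cubic_form v z 1 = cubic_form (fiber_vec (v $ 1) t z) z 1 +
      cubic_form (\<alpha> *\<^sub>R axis 3 1 + \<beta> *\<^sub>R axis 4 1) z 1"
    using cubic_form_add by metis
  moreover have "cubic_form (\<alpha> *\<^sub>R axis 3 1 + \<beta> *\<^sub>R axis 4 1) z 1 = of_real \<alpha> * z + of_real \<beta>"
    by (simp add: cubic_form_def axis_def)
  ultimately have "of_real \<alpha> * z + of_real \<beta> = 0"
    using assms(2) by (simp add: cubic_form_fiber_vec)
  then have "\<alpha> = 0" "\<beta> = 0" using assms(1) by (auto simp: complex_eq_iff)
  then show ?thesis
    unfolding t_def[symmetric] by (simp add: vec_eq_iff forall_4 \<alpha>_def \<beta>_def t_def)
qed

section \<open>Existence and uniqueness of the non-real root\<close>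

lemma cubic_disc_neg_of_root:
  assumes "Im z > 0" and "cubic_form v z 1 = 0" and "v \<noteq> 0"
  shows "cubic_disc v < 0"
  using fiber_vec_of_root[OF assms(1,2)] assms cubic_disc_fiber_vec_neg fiber_vec_eq_0_iff
  by (metis prod.inject)

text \<open>In the factorization at \<open>z\<close>, the conjugate factor vanishes only in the
  lower half-plane and the real linear factor at no non-real point.\<close>

lemma root_unique:
  assumes "Im z > 0" and "cubic_form v z 1 = 0" and "Im z' > 0" and "cubic_form v z' 1 = 0" and "v \<noteq> 0"
  shows "z' = z"
proof -
  obtain s t where v: "v = fiber_vec s t z" using fiber_vec_of_root[OF assms(1,2)] by blast
  have "(of_real s * z' + of_real t) * (z' - z) * (z' - cnj z) = 0"
    using assms(4) by (simp add: v cubic_form_fiber_vec)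
  moreover have "z' \<noteq> cnj z" using assms by (auto simp: complex_eq_iff)
  moreover have "of_real s * z' + of_real t \<noteq> 0"
    using assms(3,5) by (auto simp: complex_eq_iff v fiber_vec_eq_0_iff)
  ultimately show ?thesis by simp
qed

lemma quadratic_root_ex:
  fixes b c d :: real
  assumes "c\<^sup>2 < 4 * b * d"
  shows "\<exists>z. Im z > 0 \<and> of_real b * z\<^sup>2 + of_real c * z + of_real d = 0"
proof -
  have b: "b \<noteq> 0" using assms by (auto simp: not_less)
  \<comment> \<open>The quadratic formula; the absolute value in \<open>y\<close> selects the root
    in the upper half-plane for either sign of \<open>b\<close>.\<close>
  define x y where "x = - c / (2 * b)" and "y = sqrt (4 * b * d - c\<^sup>2) / (2 * \<bar>b\<bar>)"
  have y2: "y\<^sup>2 = (4 * b * d - c\<^sup>2) / (4 * b\<^sup>2)"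
    using assms by (simp add: y_def power_divide power_mult_distrib)
  have "b * (x\<^sup>2 - y\<^sup>2) + c * x + d = 0"
    using b unfolding y2 x_def by (simp add: power2_eq_square field_simps)
  moreover have "2 * b * x * y + c * y = 0" using b by (simp add: x_def)
  ultimately have "of_real b * (Complex x y)\<^sup>2 + of_real c * Complex x y + of_real d = 0"
    by (simp add: complex_eq_iff power2_eq_square algebra_simps)
  moreover have "Im (Complex x y) > 0" using assms b by (simp add: y_def)
  ultimately show ?thesis by blast
qed

text \<open>For \<open>a = 0\<close> the root comes from a quadratic factor. Otherwise the
  fundamental theorem of algebra yields some root: a non-real one is used up to conjugation, a real
  one is divided out.\<close>

lemma neg_disc_root_ex:
  assumes "cubic_disc v < 0"
  shows "\<exists>z. Im z > 0 \<and> cubic_form v z 1 = 0"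
proof -
  define a b c d where "a = v $ 1" and "b = v $ 2" and "c = v $ 3" and "d = v $ 4"
  note defs = a_def b_def c_def d_def
  have form: "cubic_form v z 1 = of_real a * z^3 + of_real b * z\<^sup>2 + of_real c * z + of_real d" for z
    by (simp add: cubic_form_def defs)
  have disc: "b^2 * c^2 - 4 * a * c^3 - 4 * b^3 * d - 27 * a^2 * d^2 + 18 * a * b * c * d < 0"
    using assms by (simp add: cubic_disc_def Let_def defs)
  show ?thesis
  proof (cases "a = 0")
    case True
    then have "b\<^sup>2 * (c\<^sup>2 - 4 * b * d) < 0"
      using disc by (simp add: algebra_simps power2_eq_square power3_eq_cube)
    then have "c\<^sup>2 < 4 * b * d" by (auto simp: mult_less_0_iff)
    then show ?thesis using quadratic_root_ex True by (simp add: form)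
  next
    case False
    have "\<exists>z. poly [:of_real d, of_real c, of_real b, of_real a:] z = (0 :: complex)"
      using False 
      by (intro fundamental_theorem_of_algebra) (simp add: constant_degree)
    then obtain z where z: "cubic_form v z 1 = 0"
      by (auto simp: form algebra_simps power2_eq_square power3_eq_cube)
    show ?thesis
    proof (cases "Im z = 0")
      case True
      then obtain r where r: "z = of_real r" by (metis complex_is_Real_iff Reals_cases)
      have "of_real (a * r^3 + b * r\<^sup>2 + c * r + d) = (0 :: complex)"
        using z by (simp add: form r)
      then have d: "d = - (a * r^3 + b * r\<^sup>2 + c * r)" unfolding of_real_eq_0_iff by linarith
      \<comment> \<open>The discriminant of \<open>(x - r) q\<close> is that of \<open>q\<close>
        times \<open>q(r)^2\<close>, and here \<open>q(r) = 3 a r^2 + 2 b r + c\<close>; hence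
        \<open>q\<close> has negative discriminant.\<close>
      have "((b + a * r)\<^sup>2 - 4 * a * (c + b * r + a * r\<^sup>2)) * (3 * a * r\<^sup>2 + 2 * b * r + c)\<^sup>2 < 0"
        using disc unfolding d by (simp add: algebra_simps power2_eq_square power3_eq_cube)
      then have "(b + a * r)\<^sup>2 < 4 * a * (c + b * r + a * r\<^sup>2)" by (auto simp: mult_less_0_iff)
      then obtain w where w: "Im w > 0"
        "of_real a * w\<^sup>2 + of_real (b + a * r) * w + of_real (c + b * r + a * r\<^sup>2) = (0 :: complex)"
        using quadratic_root_ex by blast
      have "cubic_form v w 1 = (w - of_real r) *
          (of_real a * w\<^sup>2 + of_real (b + a * r) * w + of_real (c + b * r + a * r\<^sup>2))"
        by (simp add: form d algebra_simps power2_eq_square power3_eq_cube)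
      then show ?thesis using w by auto
    next
      case False
      have "cubic_form v (cnj z) 1 = cnj (cubic_form v z 1)" by (simp add: form)
      then have "cubic_form v (cnj z) 1 = 0" using z by simp
      moreover have "Im z > 0 \<or> Im (cnj z) > 0" using False by auto
      ultimately show ?thesis using z by blast
    qed
  qed
qed

section \<open>The root and the fibers on scaling classes\<close>

lemma nonreal_root_proj_eq:
  assumes "Im z > 0" and "cubic_form v z 1 = 0" and "v \<noteq> 0"
  shows "nonreal_root (proj v) = z"
  unfolding nonreal_root_def
proof (rule the_equality)
  show "0 < Im z \<and> (\<forall>w\<in>Rep_rp3 (proj v). cubic_form w z 1 = 0)"
    using assms by (auto simp: Rep_rp3_proj span_singleton cubic_form_scale)
next
  fix z' assume z': "0 < Im z' \<and> (\<forall>w\<in>Rep_rp3 (proj v). cubic_form w z' 1 = 0)"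
  then have "cubic_form v z' 1 = 0" using assms(3) by (auto simp: Rep_rp3_proj span_base)
  then show "z' = z" using z' assms root_unique by blast
qed

lemma neg_disc_nonzero: "cubic_disc v < 0 \<Longrightarrow> v \<noteq> 0"
  by (auto simp: cubic_disc_def)

lemma nonreal_root_proj:
  assumes "cubic_disc v < 0"
  shows "Im (nonreal_root (proj v)) > 0" and "cubic_form v (nonreal_root (proj v)) 1 = 0"
  using neg_disc_root_ex[OF assms] nonreal_root_proj_eq neg_disc_nonzero[OF assms] by auto

lemma cubic_disc_scale: "cubic_disc (k *\<^sub>R v) = k^4 * cubic_disc v"
  by (simp add: cubic_disc_def Let_def algebra_simps power2_eq_square power3_eq_cube power4_eq_xxxx)

lemma proj_in_neg_disc_cubics_iff:
  assumes "v \<noteq> 0"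
  shows "proj v \<in> neg_disc_cubics \<longleftrightarrow> cubic_disc v < 0"
proof
  assume "proj v \<in> neg_disc_cubics"
  then obtain w where w: "cubic_disc w < 0" "proj v = proj w" by (auto simp: neg_disc_cubics_def)
  then obtain k where k: "v = k *\<^sub>R w" using proj_eq_iff assms neg_disc_nonzero by blast
  then have "k \<noteq> 0" using assms by auto
  then have "k^4 > 0" by simp
  then show "cubic_disc v < 0" using w k by (simp add: cubic_disc_scale mult_less_0_iff)
qed (auto simp: neg_disc_cubics_def)

text \<open>Turns the fiber into a linear condition on coefficient vectors, the form in which it is
  compared with a linear subspace.\<close>

lemma proj_in_cubic_fiber_iff:
  assumes "v \<noteq> 0" and "Im z > 0"
  shows "proj v \<in> cubic_fiber z \<longleftrightarrow> cubic_form v z 1 = 0"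
proof
  assume "proj v \<in> cubic_fiber z"
  then obtain w s t where w: "proj v = proj w" and st: "(s, t) \<noteq> (0 :: real, 0 :: real)"
    and form: "\<And>x y. cubic_form w x y = (of_real s * x + of_real t * y) * (x - z * y) * (x - cnj z * y)"
    unfolding cubic_fiber_def by blast
  \<comment> \<open>\<open>proj\<close> is meaningful only for nonzero vectors, and the definition
    of the fiber leaves this implicit. Evaluating the form at \<open>(1, 0)\<close> and
    \<open>(0, 1)\<close> recovers \<open>s\<close> and \<open>t |z|^2\<close>.\<close>
  have "w \<noteq> 0"
  proof
    assume "w = 0"
    have "z \<noteq> 0" using assms(2) by auto
    have "cubic_form w x y = 0" for x y by (simp add: \<open>w = 0\<close> cubic_form_def)
    then have "s = 0" "t = 0"
      using form[of 1 0] form[of 0 1] \<open>z \<noteq> 0\<close> by simp_all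
    with st show False by simp
  qed
  then obtain k where "v = k *\<^sub>R w" using w proj_eq_iff assms(1) by blast
  then show "cubic_form v z 1 = 0" using form[of z 1] by (simp add: cubic_form_scale)
next
  assume "cubic_form v z 1 = 0"
  then obtain s t where v: "v = fiber_vec s t z" using fiber_vec_of_root assms(2) by blast
  moreover have "(s, t) \<noteq> (0, 0)" using assms(1) v by (auto simp: fiber_vec_eq_0_iff)
  ultimately show "proj v \<in> cubic_fiber z"
    unfolding cubic_fiber_def using cubic_form_fiber_vec by blast
qed


subsection \<open>Smoothness of the root\<close>

lemma continuous_on_fiber_vec [continuous_intros]:
  assumes "continuous_on A f" and "continuous_on A g" and "continuous_on A h"
  shows "continuous_on A (\<lambda>x. fiber_vec (f x) (g x) (h x))"
proof -
  have "fiber_vec s t z = s *\<^sub>R axis 1 1 + (t - 2 * Re z * s) *\<^sub>R axis 2 1 +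
      ((cmod z)\<^sup>2 * s - 2 * Re z * t) *\<^sub>R axis 3 1 + ((cmod z)\<^sup>2 * t) *\<^sub>R axis 4 1" for s t z
    by (simp add: vec_eq_iff forall_4 axis_def)
  then show ?thesis using assms by (auto intro!: continuous_intros)
qed

lemma open_neg_disc: "open {v. cubic_disc v < 0}"
proof -
  have "continuous_on UNIV cubic_disc"
    unfolding cubic_disc_def Let_def by (intro continuous_intros)
  then show ?thesis by (intro open_Collect_less) auto
qed

text \<open>By invariance of domain, the continuous injection \<open>fiber_vec\<close> between open subsets of
  4-dimensional spaces has a continuous inverse, and the root is one of its components.\<close>

lemma continuous_on_root: "continuous_on {v. cubic_disc v < 0} (\<lambda>v. nonreal_root (proj v))"
proof -
  define D where "D = {q :: (real \<times> real) \<times> complex. fst q \<noteq> (0, 0) \<and> 0 < Im (snd q)}"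
  define F where "F = (\<lambda>q :: (real \<times> real) \<times> complex. fiber_vec (fst (fst q)) (snd (fst q)) (snd q))"
  have openD: "open D"
    unfolding D_def by (intro open_Collect_conj open_Collect_neq open_Collect_less continuous_intros)
  have root: "nonreal_root (proj (F q)) = snd q" if "q \<in> D" for q
    using that by (intro nonreal_root_proj_eq)
      (auto simp: D_def F_def cubic_form_fiber_vec fiber_vec_eq_0_iff prod_eq_iff)
  have "inj_on F D"
  proof (rule inj_onI)
    fix q q' assume q: "q \<in> D" "q' \<in> D" "F q = F q'"
    then have "snd q = snd q'" using root by metis
    moreover have "fst (fst q) = fst (fst q')"
      using arg_cong[OF q(3), of "\<lambda>v. v $ 1"] by (simp add: F_def)
    moreover from calculation have "snd (fst q) = snd (fst q')"
      using arg_cong[OF q(3), of "\<lambda>v. v $ 2"] by (simp add: F_def)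
    ultimately show "q = q'" by (simp add: prod_eq_iff)
  qed
  moreover have "continuous_on D F"
    unfolding F_def by (intro continuous_intros)
  ultimately obtain G where G: "homeomorphism D (F ` D) F G"
    using invariance_of_domain_homeomorphism[OF openD, of F] by auto
  have "{v. cubic_disc v < 0} \<subseteq> F ` D"
  proof
    fix v assume "v \<in> {v. cubic_disc v < 0}"
    then have v: "cubic_disc v < 0" by simp
    then obtain z where z: "Im z > 0" "cubic_form v z 1 = 0" using neg_disc_root_ex by blast
    then obtain s t where st: "v = fiber_vec s t z" using fiber_vec_of_root by blast
    then have "(s, t) \<noteq> (0, 0)" using neg_disc_nonzero[OF v] by (auto simp: fiber_vec_eq_0_iff)
    then show "v \<in> F ` D"
      using st z by (intro image_eqI[of _ _ "((s, t), z)"]) (auto simp: F_def D_def)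
  qed
  moreover have "continuous_on (F ` D) (\<lambda>v. snd (G v))"
    using G by (intro continuous_intros) (auto simp: homeomorphism_def)
  moreover have "snd (G v) = nonreal_root (proj v)" if "v \<in> F ` D" for v
    using G root that by (auto simp: homeomorphism_def)
  ultimately show ?thesis by (simp add: continuous_on_subset cong: continuous_on_cong)
qed

definition cubic_form_deriv :: "real^4 \<Rightarrow> complex \<Rightarrow> complex" where
  "cubic_form_deriv v z = 3 * of_real (v $ 1) * z\<^sup>2 + 2 * of_real (v $ 2) * z + of_real (v $ 3)"

text \<open>The root is simple: differentiating the factored cubic at \<open>z\<close> leaves
  \<open>(s z + t) (z - cnj z)\<close>, a product of nonzero numbers.\<close>

lemma cubic_form_deriv_root_nonzero:
  assumes "Im z > 0" and "cubic_form v z 1 = 0" and "v \<noteq> 0"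
  shows "cubic_form_deriv v z \<noteq> 0"
proof -
  obtain s t where v: "v = fiber_vec s t z" using fiber_vec_of_root[OF assms(1,2)] by blast
  have 1: "of_real (2 * Re z) = z + cnj z" by (simp add: complex_add_cnj)
  have 2: "of_real ((cmod z)\<^sup>2) = z * cnj z" by (rule complex_norm_square)
  have "cubic_form_deriv v z = (of_real s * z + of_real t) * (z - cnj z)"
    unfolding v cubic_form_deriv_def fiber_vec_nth of_real_diff of_real_mult[of "2 * Re z"]
      of_real_mult[of "(cmod z)\<^sup>2"] 1 2
    by (simp add: algebra_simps power2_eq_square)
  moreover have "z \<noteq> cnj z" using assms(1) by (auto simp: complex_eq_iff)
  moreover have "of_real s * z + of_real t \<noteq> 0"
    using assms(1,3) by (auto simp: complex_eq_iff v fiber_vec_eq_0_iff)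
  ultimately show ?thesis by simp
qed

lemma bounded_linear_of_real_vec_nth: "bounded_linear (\<lambda>v :: real^'n. of_real (v $ i) :: complex)"
  by (intro bounded_linear_compose[OF bounded_linear_of_real] bounded_linear_vec_nth)

text \<open>Implicit differentiation, with the difference quotient \<open>Q\<close> of the cubic in place of its
  derivative.\<close>

lemma has_derivative_root:
  assumes "cubic_disc v < 0"
  shows "((\<lambda>v. nonreal_root (proj v)) has_derivative
    (\<lambda>h. - cubic_form h (nonreal_root (proj v)) 1 / cubic_form_deriv v (nonreal_root (proj v)))) (at v)"
proof -
  define r where "r = (\<lambda>v. nonreal_root (proj v))"
  define Q where "Q = (\<lambda>x. of_real (v $ 1) * ((r v)\<^sup>2 + r v * r x + (r x)\<^sup>2) +
      of_real (v $ 2) * (r v + r x) + of_real (v $ 3))"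
  \<comment> \<open>The coefficients of \<open>h\<close> are kept as separate linear factors, so
    that each summand has the form covered by
    \<open>has_derivative_linear_mult_isCont\<close>.\<close>
  define T where "T = (\<lambda>(h :: real^4) x. of_real (h $ 1) * (- (r x ^ 3) / Q x) + of_real (h $ 2) * (- ((r x)\<^sup>2) / Q x) +
      of_real (h $ 3) * (- r x / Q x) + of_real (h $ 4) * (- 1 / Q x))"
  have T: "T h x = - cubic_form h (r x) 1 / Q x" for h x
    by (simp add: T_def cubic_form_def add_divide_distrib diff_divide_distrib)
  let ?X = "{v. cubic_disc v < 0}"
  have r: "Im (r x) > 0" "cubic_form x (r x) 1 = 0" if "x \<in> ?X" for x
    using that nonreal_root_proj by (auto simp: r_def)
  have cont: "isCont r v"
    using continuous_on_root open_neg_disc assms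
    by (auto simp: r_def continuous_on_eq_continuous_at)
  then have contQ: "isCont Q v" unfolding Q_def by (intro continuous_intros)
  have Qv: "Q v = cubic_form_deriv v (r v)"
    by (simp add: Q_def cubic_form_deriv_def power2_eq_square algebra_simps)
  then have Qv0: "Q v \<noteq> 0"
    using cubic_form_deriv_root_nonzero r assms neg_disc_nonzero by auto
  have ev1: "eventually (\<lambda>x. Q x \<noteq> 0) (at v)"
    using contQ Qv0 by (auto simp: isCont_def intro: tendsto_imp_eventually_ne)
  have ev2: "eventually (\<lambda>x. x \<in> ?X) (at v)"
    using open_neg_disc assms eventually_at_topological by blast
  have step: "r v + T (x - v) x = r x" if "Q x \<noteq> 0" "x \<in> ?X" for x
  proof -
    \<comment> \<open>Since the cubic \<open>x\<close> vanishes at \<open>r x\<close>, the value of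
      \<open>v\<close> there is minus that of \<open>x - v\<close>.\<close>
    have "cubic_form v (r x) 1 - cubic_form v (r v) 1 = (r x - r v) * Q x"
      by (simp add: cubic_form_def Q_def algebra_simps power2_eq_square power3_eq_cube)
    then have "(r x - r v) * Q x = - cubic_form (x - v) (r x) 1"
      using r[of x] r[of v] that assms by (simp add: cubic_form_diff)
    then have "r x - r v = - cubic_form (x - v) (r x) 1 / Q x"
      using that(1) by (simp add: field_simps)
    then show ?thesis unfolding T by (simp add: algebra_simps)
  qed
  have ev: "eventually (\<lambda>x. r v + T (x - v) x = r x) (at v)"
    using ev1 ev2 by eventually_elim (rule step)
  have "((\<lambda>x. r v + T (x - v) x) has_derivative (\<lambda>h. 0 + T h v)) (at v)"
    using Qv0 unfolding T_def
    by (intro has_derivative_add has_derivative_const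
        has_derivative_linear_mult_isCont[OF bounded_linear_of_real_vec_nth]
        continuous_intros cont contQ)
  then have "(r has_derivative (\<lambda>h. 0 + T h v)) (at v)"
    by (rule has_derivative_transform_eventually[OF _ ev]) (simp_all add: T cubic_form_def)
  then show ?thesis by (simp add: T Qv) (simp add: r_def)
qed

text \<open>Bootstrapping: the derivative is a rational expression in the coefficients and the root
  itself, with nonvanishing denominator, so class \<open>C^k\<close> of the root yields class
  \<open>C^(k+1)\<close>.\<close>

lemma Ck_on_root: "Ck_on k {v. cubic_disc v < 0} (\<lambda>v. nonreal_root (proj v))"
proof (induction k)
  case 0
  then show ?case by (simp add: continuous_on_root)
next
  case (Suc k)
  note opn = open_neg_disc
  have nth: "Ck_on k {v. cubic_disc v < 0} (\<lambda>v. of_real (v $ i) :: complex)" for i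
    using Ck_on_affine[OF opn bounded_linear_of_real_vec_nth, of k 0] by simp
  have nz: "cubic_form_deriv v (nonreal_root (proj v)) \<noteq> 0" if "v \<in> {v. cubic_disc v < 0}" for v
    using that cubic_form_deriv_root_nonzero nonreal_root_proj neg_disc_nonzero by auto
  show ?case
  proof (rule Ck_on_SucI[OF opn])
    show "((\<lambda>v. nonreal_root (proj v)) has_derivative (\<lambda>h. (- 1) * cubic_form h (nonreal_root (proj v)) 1
        * inverse (cubic_form_deriv v (nonreal_root (proj v))))) (at v)"
      if "v \<in> {v. cubic_disc v < 0}" for v
      using has_derivative_root that by (simp add: divide_inverse)
    have "Ck_on k {v. cubic_disc v < 0} (\<lambda>v. cubic_form_deriv v (nonreal_root (proj v)))"
      unfolding cubic_form_deriv_def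
      by (intro Ck_on_add Ck_on_mult Ck_on_power Ck_on_const opn nth Suc)
    moreover have "Ck_on k {v. cubic_disc v < 0} (\<lambda>v. cubic_form h (nonreal_root (proj v)) 1)" for h
      unfolding cubic_form_def
      by (intro Ck_on_add Ck_on_mult Ck_on_power Ck_on_const opn nth Suc)
    ultimately show "Ck_on k {v. cubic_disc v < 0} (\<lambda>v. (- 1) * cubic_form h (nonreal_root (proj v)) 1
        * inverse (cubic_form_deriv v (nonreal_root (proj v))))" for h
      using nz by (intro Ck_on_mult Ck_on_inverse Ck_on_const opn) auto
  qed
qed


subsection \<open>Linear sections\<close>

lemma tangent_space_mono: "M \<subseteq> N \<Longrightarrow> tangent_space M y \<subseteq> tangent_space N y"
  unfolding tangent_space_def by blast

text \<open>Velocities are limits of difference quotients. In their images under \<open>L\<close>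
  the offset \<open>e\<close> cancels, so these lie in the subspace \<open>W\<close>, which is
  closed.\<close>

lemma tangent_space_affine_subset:
  fixes L :: "'a::euclidean_space \<Rightarrow> 'b::euclidean_space"
  assumes "linear L" and "subspace W" and "\<And>x. x \<in> M \<Longrightarrow> e + L x \<in> W" and "d \<in> tangent_space M y"
  shows "L d \<in> W"
proof -
  obtain c \<epsilon> where c: "0 < \<epsilon>" "c ` {-\<epsilon><..<\<epsilon>} \<subseteq> M" "(c has_vector_derivative d) (at (0::real))"
    using assms(4) unfolding tangent_space_def by blast
  have "((\<lambda>t. (c t - c 0) /\<^sub>R t) \<longlongrightarrow> d) (at 0)"
  proof (rule LIM_zero_cancel, rule tendsto_norm_zero_cancel)
    have "((\<lambda>t. norm (c t - c 0 - t *\<^sub>R d) / norm t) \<longlongrightarrow> 0) (at 0)"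
      using c(3) by (simp add: has_vector_derivative_def has_derivative_iff_norm)
    moreover have "norm (c t - c 0 - t *\<^sub>R d) / norm t = norm ((c t - c 0) /\<^sub>R t - d)" if "t \<noteq> 0" for t
    proof -
      have "c t - c 0 - t *\<^sub>R d = t *\<^sub>R ((c t - c 0) /\<^sub>R t - d)"
        using that by (simp add: scaleR_diff_right)
      then have "norm (c t - c 0 - t *\<^sub>R d) = \<bar>t\<bar> * norm ((c t - c 0) /\<^sub>R t - d)"
        by (metis norm_scaleR)
      then show ?thesis using that by simp
    qed
    ultimately show "((\<lambda>t. norm ((c t - c 0) /\<^sub>R t - d)) \<longlongrightarrow> 0) (at 0)"
      by (simp cong: LIM_cong)
  qed
  then have lim: "((\<lambda>t. L ((c t - c 0) /\<^sub>R t)) \<longlongrightarrow> L d) (at 0)"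
    by (rule bounded_linear.tendsto[OF linear_conv_bounded_linear[THEN iffD1, OF assms(1)]])
  have "eventually (\<lambda>t. t \<in> {-\<epsilon><..<\<epsilon>}) (at 0)"
    using c(1) by (intro eventually_at_in_open') auto
  then have "eventually (\<lambda>t. L ((c t - c 0) /\<^sub>R t) \<in> W) (at 0)"
  proof eventually_elim
    fix t assume "t \<in> {-\<epsilon><..<\<epsilon>}"
    then have "c t \<in> M" "c 0 \<in> M" using c(1,2) by (auto simp: image_subset_iff)
    then have "e + L (c t) \<in> W" "e + L (c 0) \<in> W" using assms(3) by blast+
    then have "(1 / t) *\<^sub>R ((e + L (c t)) - (e + L (c 0))) \<in> W"
      using assms(2) subspace_diff subspace_scale by blast
    then show "L ((c t - c 0) /\<^sub>R t) \<in> W"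
      using assms(1) by (simp add: linear_cmul linear_diff inverse_eq_divide)
  qed
  then show ?thesis
    using Lim_in_closed_set[OF closed_subspace[OF assms(2)] _ _ lim] by simp
qed

lemma tangent_space_affine_superset:
  assumes "\<And>t. y + t *\<^sub>R d \<in> M"
  shows "d \<in> tangent_space M y"
  unfolding tangent_space_def
proof (intro CollectI exI conjI)
  show "(0::real) < 1" by simp
  show "smooth_on {-1<..<1} (\<lambda>t. y + t *\<^sub>R d)"
    unfolding smooth_on_def by (auto intro!: Ck_on_affine bounded_linear_scaleR_left)
  show "((\<lambda>t. y + t *\<^sub>R d) has_vector_derivative d) (at 0)"
    by (auto intro!: derivative_eq_intros)
qed (use assms in auto)

section \<open>Sections of the negative-discriminant locus by a linear subspace\<close>

locale cubic_section =
  fixes W :: "(real^4) set" and S :: "rp3 set"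
  assumes W: "subspace W" and S: "S = {p. Rep_rp3 p \<subseteq> W} \<inter> neg_disc_cubics"
begin

lemma proj_in_S_iff: "v \<noteq> 0 \<Longrightarrow> proj v \<in> S \<longleftrightarrow> v \<in> W \<and> cubic_disc v < 0"
  by (simp add: S Rep_rp3_proj_subset_iff[OF _ W] proj_in_neg_disc_cubics_iff)

lemma S_cases:
  assumes "p \<in> S"
  obtains v where "v \<noteq> 0" and "p = proj v" and "v \<in> W" and "cubic_disc v < 0"
    and "Im (nonreal_root p) > 0" and "cubic_form v (nonreal_root p) 1 = 0"
  by (metis assms nonreal_root_proj proj_in_S_iff rp3_cases)

lemma cubic_fiber_subset_S:
  assumes "Im z > 0" and "{v. cubic_form v z 1 = 0} \<subseteq> W"
  shows "cubic_fiber z \<subseteq> S"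
proof
  fix p assume p: "p \<in> cubic_fiber z"
  obtain v where v: "v \<noteq> 0" "p = proj v" using rp3_cases by blast
  then have "cubic_form v z 1 = 0" using p proj_in_cubic_fiber_iff assms(1) by blast
  then show "p \<in> S" using v assms proj_in_S_iff cubic_disc_neg_of_root by blast
qed

text \<open>In a chart, tangency to \<open>S\<close> puts the direction of the fiber into
  \<open>W\<close>; together with the vector of \<open>p\<close> it generates all cubics vanishing
  at the root. Conversely, if \<open>W\<close> contains these cubics, the entire fiber lies in
  \<open>S\<close>.\<close>

lemma transverse_iff:
  assumes "p \<in> S"
  shows "transverse_to_fiber_at S p \<longleftrightarrow> \<not> {v. cubic_form v (nonreal_root p) 1 = 0} \<subseteq> W"
proof -
  define z where "z = nonreal_root p"
  obtain v where v: "v \<noteq> 0" "p = proj v" "v \<in> W" "Im z > 0" "cubic_form v z 1 = 0"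
    using S_cases[OF assms] unfolding z_def by metis
  have "w \<in> W" if tan: "rp3_tangent_subset p (cubic_fiber z) S" and w: "cubic_form w z 1 = 0" for w
  proof -
    obtain \<psi> y where \<psi>: "\<psi> \<in> affine_params" and y: "\<psi> y = p"
      using affine_params_cover[OF v(1)] v(2) by metis
    obtain i e L where L: "linear L" "inj L" "range L = {v. v $ i = 0}" "e $ i = 1"
      and nz: "\<And>y. e + L y \<noteq> 0" and \<psi>_eq: "\<psi> = (\<lambda>y. proj (e + L y))"
      by (rule affine_params_cases[OF \<psi>]) (rule that)
    have Li: "L x $ i = 0" for x using L(3) by blast
    have yW: "e + L y \<in> W"
      using y assms proj_in_S_iff[OF nz] by (auto simp: \<psi>_eq)
    have yz: "cubic_form (e + L y) z 1 = 0"
      using y v proj_in_cubic_fiber_iff nz by (metis \<psi>_eq)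
    \<comment> \<open>As \<open>e + L y\<close> has coordinate \<open>i\<close> equal to 1,
      subtracting this multiple removes coordinate \<open>i\<close> from \<open>w\<close> and leaves
      a direction \<open>L d\<close> of the chart.\<close>
    have "w - (w $ i) *\<^sub>R (e + L y) \<in> range L" using L Li by simp
    then obtain d where d: "L d = w - (w $ i) *\<^sub>R (e + L y)" by force
    have "y + t *\<^sub>R d \<in> \<psi> -` cubic_fiber z" for t
    proof -
      have "cubic_form (L d) z 1 = 0" using d w yz by (simp add: cubic_form_diff cubic_form_scale)
      then have "cubic_form ((e + L y) + t *\<^sub>R L d) z 1 = 0"
        using yz by (simp only: cubic_form_add[of "e + L y"] cubic_form_scale) simp
      then have "cubic_form (e + L (y + t *\<^sub>R d)) z 1 = 0"
        using L(1) by (simp add: linear_add linear_cmul add.assoc)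
      then show ?thesis
        using proj_in_cubic_fiber_iff[OF nz v(4)] by (simp add: \<psi>_eq)
    qed
    then have "d \<in> tangent_space (\<psi> -` S) y"
      using tan \<psi> y tangent_space_affine_superset unfolding rp3_tangent_subset_def by blast
    then have "L d \<in> W"
      by (rule tangent_space_affine_subset[OF L(1) W, rotated])
        (use proj_in_S_iff[OF nz] in \<open>auto simp: \<psi>_eq\<close>)
    then have "L d + (w $ i) *\<^sub>R (e + L y) \<in> W"
      using yW W subspace_add subspace_scale by blast
    then show "w \<in> W" by (simp add: d)
  qed
  moreover have "rp3_tangent_subset p (cubic_fiber z) S" if "{v. cubic_form v z 1 = 0} \<subseteq> W"
    unfolding rp3_tangent_subset_def
    using tangent_space_mono[OF vimage_mono[OF cubic_fiber_subset_S[OF v(4) that]]] by blast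
  ultimately show ?thesis
    unfolding transverse_to_fiber_at_def z_def by blast
qed

lemma inj_on_imp_transverse:
  assumes "inj_on nonreal_root S" and "p \<in> S"
  shows "transverse_to_fiber_at S p"
proof (rule ccontr)
  assume "\<not> transverse_to_fiber_at S p"
  define z where "z = nonreal_root p"
  have z: "Im z > 0" using S_cases[OF assms(2)] z_def by metis
  have sub: "{v. cubic_form v z 1 = 0} \<subseteq> W"
    using transverse_iff[OF assms(2)] \<open>\<not> transverse_to_fiber_at S p\<close> z_def by simp
  have *: "proj (fiber_vec s t z) \<in> S" "nonreal_root (proj (fiber_vec s t z)) = z"
    if "(s, t) \<noteq> (0, 0)" for s t
  proof -
    have nz: "fiber_vec s t z \<noteq> 0" using that by (auto simp: fiber_vec_eq_0_iff)
    have root: "cubic_form (fiber_vec s t z) z 1 = 0" by (simp add: cubic_form_fiber_vec)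
    show "proj (fiber_vec s t z) \<in> S"
      using sub root nz z proj_in_S_iff cubic_disc_neg_of_root by blast
    show "nonreal_root (proj (fiber_vec s t z)) = z"
      using nonreal_root_proj_eq z root nz by blast
  qed
  \<comment> \<open>The test pair consists of the cubics of the fiber with real roots
    \<open>[0 : 1]\<close> and \<open>[1 : 0]\<close>. Injectivity identifies them, although their
    first coefficients are 1 and 0.\<close>
  have "proj (fiber_vec 1 0 z) = proj (fiber_vec 0 1 z)"
    using *[of 1 0] *[of 0 1] by (intro inj_onD[OF assms(1)]) auto
  then obtain k where "fiber_vec 1 0 z = k *\<^sub>R fiber_vec 0 1 z"
    using proj_eq_iff by (metis fiber_vec_eq_0_iff zero_neq_one)
  then have "fiber_vec 1 0 z $ 1 = (k *\<^sub>R fiber_vec 0 1 z) $ 1" by simp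
  then show False by simp
qed

text \<open>A functional vanishing on \<open>W\<close> but not on the fiber cuts out the only point of the fiber
  that can lie on \<open>W\<close>.\<close>

definition section_vec :: "real^4 \<Rightarrow> complex \<Rightarrow> real^4" where
  "section_vec l z = fiber_vec (l \<bullet> fiber_vec 0 1 z) (- (l \<bullet> fiber_vec 1 0 z)) z"

text \<open>In the basis \<open>fiber_vec 1 0 z\<close>, \<open>fiber_vec 0 1 z\<close> the
  functional has coordinates \<alpha> and \<beta>, and the kernel of a nonzero functional on a plane
  is the line through \<open>(\<beta>, - \<alpha>)\<close>.\<close>

lemma section_vec_parallel:
  assumes "\<And>w. w \<in> W \<Longrightarrow> l \<bullet> w = 0" and "Im z > 0" and "section_vec l z \<noteq> 0"
    and "v \<in> W" and "cubic_form v z 1 = 0"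
  shows "\<exists>k. v = k *\<^sub>R section_vec l z"
proof -
  define \<alpha> \<beta> where "\<alpha> = l \<bullet> fiber_vec 1 0 z" and "\<beta> = l \<bullet> fiber_vec 0 1 z"
  obtain s t where v: "v = fiber_vec s t z" using fiber_vec_of_root assms by blast
  have eq: "s * \<alpha> + t * \<beta> = 0"
    using assms(1)[OF assms(4)] unfolding v \<alpha>_def \<beta>_def
    by (subst (asm) fiber_vec_linear) (simp add: inner_add_right)
  have nz: "\<alpha> \<noteq> 0 \<or> \<beta> \<noteq> 0"
    using assms(3) by (auto simp: section_vec_def \<alpha>_def \<beta>_def fiber_vec_eq_0_iff)
  obtain k where "s = k * \<beta>" "t = - (k * \<alpha>)"
  proof (cases "\<beta> = 0")
    case True
    then show ?thesis using that[of "- t / \<alpha>"] eq nz by (auto simp: field_simps)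
  next
    case False
    then have "t = - (s * \<alpha>) / \<beta>" using eq by (simp add: field_simps)
    then show ?thesis using that[of "s / \<beta>"] False by (simp add: field_simps)
  qed
  then have "v = k *\<^sub>R section_vec l z"
    by (simp add: v section_vec_def \<alpha>_def \<beta>_def vec_eq_iff forall_4 algebra_simps)
  then show ?thesis by blast
qed

lemma section_vec_ex:
  assumes "p \<in> S" and "transverse_to_fiber_at S p"
  obtains l where "\<And>w. w \<in> W \<Longrightarrow> l \<bullet> w = 0" and "section_vec l (nonreal_root p) \<noteq> 0"
proof -
  define z where "z = nonreal_root p"
  have z: "Im z > 0" using S_cases[OF assms(1)] z_def by metis
  obtain u where u: "cubic_form u z 1 = 0" "u \<notin> W"
    using assms transverse_iff z_def by blast
  \<comment> \<open>The normal \<open>l\<close> is the component orthogonal to \<open>W\<close> of a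
    cubic \<open>u\<close> that has the root \<open>z\<close> but lies outside \<open>W\<close>;
    then \<open>l \<bullet> u = l \<bullet> l\<close> is nonzero.\<close>
  obtain w l where wl: "w \<in> span W" "\<And>x. x \<in> span W \<Longrightarrow> orthogonal l x" "u = w + l"
    using orthogonal_subspace_decomp_exists[of W u] by metis
  have spanW: "span W = W" using W by (simp add: span_eq_iff)
  have ann: "l \<bullet> x = 0" if "x \<in> W" for x
    using wl(2) that spanW by (simp add: orthogonal_def)
  have "l \<noteq> 0" using wl u spanW by auto
  moreover have "l \<bullet> u = l \<bullet> l" using wl ann spanW by (simp add: inner_add_right)
  ultimately have lu: "l \<bullet> u \<noteq> 0" by simp
  obtain s t where st: "u = fiber_vec s t z" using fiber_vec_of_root[OF z u(1)] by blast
  have "section_vec l z \<noteq> 0"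
  proof
    assume "section_vec l z = 0"
    then have "l \<bullet> fiber_vec 0 1 z = 0" "l \<bullet> fiber_vec 1 0 z = 0"
      by (auto simp: section_vec_def fiber_vec_eq_0_iff)
    then have "l \<bullet> u = 0"
      unfolding st by (subst fiber_vec_linear) (simp add: inner_add_right)
    with lu show False by simp
  qed
  then show ?thesis using that ann z_def by blast
qed

text \<open>Transversality as linear algebra: the plane of cubics with this root meets
  \<open>W\<close> in at most a line, since every common vector is a multiple of one section
  vector.\<close>

lemma transverse_parallel:
  assumes "p \<in> S" and "transverse_to_fiber_at S p" and "v \<in> W" and "cubic_form v (nonreal_root p) 1 = 0"
    and "w \<in> W" and "cubic_form w (nonreal_root p) 1 = 0" and "w \<noteq> 0"
  shows "\<exists>k. v = k *\<^sub>R w"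
proof -
  obtain l where l: "\<And>w. w \<in> W \<Longrightarrow> l \<bullet> w = 0" "section_vec l (nonreal_root p) \<noteq> 0"
    using section_vec_ex[OF assms(1,2)] by blast
  have z: "Im (nonreal_root p) > 0" using S_cases[OF assms(1)] by metis
  obtain k m where km: "v = k *\<^sub>R section_vec l (nonreal_root p)" "w = m *\<^sub>R section_vec l (nonreal_root p)"
    using section_vec_parallel[OF l(1) z l(2)] assms by metis
  then have "m \<noteq> 0" using assms(7) by auto
  then have "v = (k / m) *\<^sub>R w" using km by simp
  then show ?thesis by blast
qed

section \<open>Transversality implies an embedding\<close>

context
  assumes transverse: "\<And>p. p \<in> S \<Longrightarrow> transverse_to_fiber_at S p"
begin

lemma inj_on_root: "inj_on nonreal_root S"
proof (rule inj_onI)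
  fix p q assume pq: "p \<in> S" "q \<in> S" "nonreal_root p = nonreal_root q"
  obtain v w where v: "v \<noteq> 0" "p = proj v" "v \<in> W" "cubic_form v (nonreal_root p) 1 = 0"
    and w: "w \<noteq> 0" "q = proj w" "w \<in> W" "cubic_form w (nonreal_root p) 1 = 0"
    using S_cases[OF pq(1)] S_cases[OF pq(2)] pq(3) by metis
  then show "p = q"
    using transverse_parallel[OF pq(1) transverse[OF pq(1)]] proj_eq_iff by metis
qed

text \<open>The root composed with the chart is smooth on an open set of parameters and so serves as
  its own local extension. The kernel of its differential meets the directions of \<open>W\<close>
  only in multiples of \<open>e + L y\<close>, and no nonzero multiple is a chart direction.\<close>

lemma rp3_immersion_on_root: "rp3_immersion_on S nonreal_root"
  unfolding rp3_immersion_on_def immersion_on_def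
proof (intro ballI)
  fix \<psi> y assume \<psi>: "\<psi> \<in> affine_params" and y: "y \<in> \<psi> -` S"
  obtain i e L where L: "linear L" "inj L" "range L = {v. v $ i = 0}" "e $ i = 1"
    and nz: "\<And>y. e + L y \<noteq> 0" and \<psi>_eq: "\<psi> = (\<lambda>y. proj (e + L y))"
    by (rule affine_params_cases[OF \<psi>]) (rule that)
  have bl: "bounded_linear L" using L(1) by (simp add: linear_conv_bounded_linear)
  have Li: "L x $ i = 0" for x using L(3) by blast
  define U where "U = (\<lambda>x. e + L x) -` {v. cubic_disc v < 0}"
  have openU: "open U"
    unfolding U_def
    by (intro open_vimage open_neg_disc continuous_intros bounded_linear.continuous_on[OF bl])
  have yW: "e + L y \<in> W" and yU: "y \<in> U"
    using y proj_in_S_iff[OF nz] by (auto simp: \<psi>_eq U_def)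
  let ?g = "nonreal_root \<circ> \<psi>"
  have "smooth_on U ?g"
    unfolding smooth_on_def o_def \<psi>_eq
    using Ck_on_compose_affine[OF open_neg_disc openU bl _ Ck_on_root] by (auto simp: U_def)
  moreover have "inj_on (frechet_derivative ?g (at y)) (tangent_space (\<psi> -` S) y)"
  proof (rule inj_onI)
    define z where "z = nonreal_root (\<psi> y)"
    have z: "Im z > 0" "cubic_form (e + L y) z 1 = 0"
      using nonreal_root_proj yU by (auto simp: U_def z_def \<psi>_eq)
    have "((\<lambda>x. e + L x) has_derivative L) (at y)"
      by (auto intro!: derivative_eq_intros bounded_linear_imp_has_derivative bl)
    then have "(?g has_derivative (\<lambda>h. - cubic_form (L h) z 1 / cubic_form_deriv (e + L y) z)) (at y)"
      using has_derivative_compose[OF _ has_derivative_root] yU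
      by (fastforce simp: o_def \<psi>_eq U_def z_def)
    then have D: "frechet_derivative ?g (at y) =
        (\<lambda>h. - cubic_form (L h) z 1 / cubic_form_deriv (e + L y) z)"
      by (metis frechet_derivative_at)
    have nzd: "cubic_form_deriv (e + L y) z \<noteq> 0"
      using cubic_form_deriv_root_nonzero z nz by blast
    fix d d' assume d: "d \<in> tangent_space (\<psi> -` S) y" "d' \<in> tangent_space (\<psi> -` S) y"
      and eq: "frechet_derivative ?g (at y) d = frechet_derivative ?g (at y) d'"
    have "L h \<in> W" if "h \<in> tangent_space (\<psi> -` S) y" for h
      by (rule tangent_space_affine_subset[OF L(1) W _ that])
        (use proj_in_S_iff[OF nz] in \<open>auto simp: \<psi>_eq\<close>)
    \<comment> \<open>Differences are formed in the subspace \<open>W\<close>, where linearity is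
      available, rather than in the set of velocities.\<close>
    then have "L (d - d') \<in> W" using d W L(1) by (simp add: linear_diff subspace_diff)
    moreover have "cubic_form (L (d - d')) z 1 = 0"
      using eq nzd L(1) by (simp add: D linear_diff cubic_form_diff)
    ultimately obtain k where k: "L (d - d') = k *\<^sub>R (e + L y)"
      using transverse_parallel[OF _ transverse _ _ yW _ nz, of "\<psi> y"] y z(2) unfolding z_def by blast
    \<comment> \<open>Coordinate \<open>i\<close> is 0 for chart directions and 1 for
      \<open>e + L y\<close>, which forces \<open>k = 0\<close>.\<close>
    then have "L (d - d') $ i = (k *\<^sub>R (e + L y)) $ i" by simp
    then have "k = 0" using Li L(4) by simp
    then have "L d = L d'" using k L(1) by (simp add: linear_diff)
    then show "d = d'" using L(2) by (simp add: inj_eq)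
  qed
  ultimately show "\<exists>U g. open U \<and> y \<in> U \<and> smooth_on U g \<and>
      (\<forall>x\<in>\<psi> -` S \<inter> U. g x = (nonreal_root \<circ> \<psi>) x) \<and>
      inj_on (frechet_derivative g (at y)) (tangent_space (\<psi> -` S) y)"
    using openU yU by blast
qed

text \<open>A normal \<open>l\<close> chosen at one point keeps \<open>section_vec l\<close> nonzero
  nearby, so the inverse is locally \<open>proj\<close> of a continuous vector-valued map.\<close>

lemma continuous_on_inverse_root: "continuous_on (nonreal_root ` S) (the_inv_into S nonreal_root)"
  unfolding continuous_on_topological
proof (intro ballI allI impI)
  fix z\<^sub>0 B assume "z\<^sub>0 \<in> nonreal_root ` S" and B: "open B" "the_inv_into S nonreal_root z\<^sub>0 \<in> B"
  then obtain p where p: "p \<in> S" "z\<^sub>0 = nonreal_root p" by blast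
  then obtain l where l: "\<And>w. w \<in> W \<Longrightarrow> l \<bullet> w = 0" "section_vec l z\<^sub>0 \<noteq> 0"
    using section_vec_ex transverse by metis
  have inv: "q = proj (section_vec l (nonreal_root q))"
    if q: "q \<in> S" "section_vec l (nonreal_root q) \<noteq> 0" for q
  proof -
    obtain v where v: "v \<noteq> 0" "q = proj v" "v \<in> W" "Im (nonreal_root q) > 0"
      "cubic_form v (nonreal_root q) 1 = 0"
      using S_cases[OF q(1)] by metis
    then show ?thesis
      using section_vec_parallel[OF l(1) v(4) q(2) v(3,5)] proj_eq_iff[OF v(1) q(2)] by metis
  qed
  \<comment> \<open>This cone is open by definition of the quotient topology, and its condition
    \<open>v \<noteq> 0\<close> ensures that the section vector does not degenerate.\<close>
  let ?B = "{v. v \<noteq> 0 \<and> proj v \<in> B}"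
  have "continuous_on UNIV (section_vec l)"
    unfolding section_vec_def by (intro continuous_intros)
  then have "open (section_vec l -` ?B)"
    using B(1) by (intro open_vimage) (simp_all add: open_rp3_def)
  moreover have "z\<^sub>0 \<in> section_vec l -` ?B"
    using inv[OF p(1)] p l(2) B(2) by (simp add: the_inv_into_f_f[OF inj_on_root])
  moreover have "the_inv_into S nonreal_root z \<in> B"
    if z: "z \<in> nonreal_root ` S" "z \<in> section_vec l -` ?B" for z
  proof -
    obtain q where q: "q \<in> S" "z = nonreal_root q" using z by blast
    then show ?thesis
      using inv[OF q(1)] z(2) by (simp add: the_inv_into_f_f[OF inj_on_root])
  qed
  ultimately show "\<exists>A. open A \<and> z\<^sub>0 \<in> A \<and>
      (\<forall>z\<in>nonreal_root ` S. z \<in> A \<longrightarrow> the_inv_into S nonreal_root z \<in> B)"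
    by blast
qed

end

text \<open>Continuity descends from coefficient vectors, because the open sets of projective space
  are those with open preimage among the nonzero vectors.\<close>

lemma continuous_on_nonreal_root: "continuous_on S nonreal_root"
  unfolding continuous_on_topological
proof (intro ballI allI impI)
  fix p and B :: "complex set" assume p: "p \<in> S" "open B" "nonreal_root p \<in> B"
  define V where "V = {v. cubic_disc v < 0} \<inter> (\<lambda>v. nonreal_root (proj v)) -` B"
  have "open V"
    unfolding V_def using continuous_open_preimage[OF continuous_on_root open_neg_disc p(2)] .
  let ?A = "{q \<in> neg_disc_cubics. nonreal_root q \<in> B}"
  have "{v. v \<noteq> 0 \<and> proj v \<in> ?A} = V"
    using proj_in_neg_disc_cubics_iff neg_disc_nonzero by (auto simp: V_def)
  then have "open ?A" using \<open>open V\<close> by (simp add: open_rp3_def)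
  then show "\<exists>A. open A \<and> p \<in> A \<and> (\<forall>q\<in>S. q \<in> A \<longrightarrow> nonreal_root q \<in> B)"
    using p S by (intro exI[of _ ?A]) auto
qed

end

theorem corollary4p15:
  fixes P S :: "rp3 set"
  assumes "projective_subspace 1 P \<or> projective_subspace 2 P"
    and "S = P \<inter> neg_disc_cubics"
    and "S \<noteq> {}"
  shows "rp3_embedding_on S nonreal_root \<longleftrightarrow> (\<forall>p\<in>S. transverse_to_fiber_at S p)"
proof -
  obtain W where "subspace W" "P = {p. Rep_rp3 p \<subseteq> W}"
    using assms(1) unfolding projective_subspace_def by blast
  then interpret cubic_section W S using assms(2) by unfold_locales auto
  show ?thesis
  proof
    assume "rp3_embedding_on S nonreal_root"
    then show "\<forall>p\<in>S. transverse_to_fiber_at S p"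
      using inj_on_imp_transverse by (simp add: rp3_embedding_on_def)
  next
    assume tr: "\<forall>p\<in>S. transverse_to_fiber_at S p"
    then have inj: "inj_on nonreal_root S" using inj_on_root by blast
    have "homeomorphism S (nonreal_root ` S) nonreal_root (the_inv_into S nonreal_root)"
      using tr inj continuous_on_nonreal_root continuous_on_inverse_root
      by (auto simp: homeomorphism_def the_inv_into_f_f the_inv_into_onto)
    then show "rp3_embedding_on S nonreal_root"
      unfolding rp3_embedding_on_def using tr inj rp3_immersion_on_root by blast
  qed
qed

end
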